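(* Given a data distribution $P$, under the assumption that $l(\cdot;z)$ is an $L$-Lipschitz, $\beta$-smooth convex quadratic loss function defined on a bounded domain for every $z$, the heavy ball method with a fixed step-size $\eta\in\left(0,\frac{1-\gamma}{\beta}\right)$ and a fixed momentum parameter $\gamma\in[0,1)$ (run on the empirical risk $R_S$ with sample size $n$), which outputs $\hat\theta_T$ at iteration $T$, has the following uniform stability bound for all $T\ge1$: $$\mathcal E_{\mathrm{stab}}^{\mathrm{HB,\,fixed}}(\hat\theta_T,l,P,n)\le\frac{4\eta L^2T}{(1-\sqrt\gamma)\,n}.$$
   Context: $\Omega\subset\mathbb R^d$ is the (bounded) parameter domain, $\mathcal Z$ the sample space, and $l(\theta;z)$ the loss for $\theta\in\Omega$, $z\in\mathcal Z$; for a sample $S=(z_1,\dots,z_n)$ drawn i.i.d. from $P$, the empirical risk is $R_S(\theta)=\frac1n\sum_{j=1}^n l(\theta;z_j)$. The heavy ball method with fixed step-size $\eta$ and fixed momentum parameter $\gamma$ on an objective $F$ has the updates, for $t\ge1$, $$\theta_{t+1}=\theta_t-\eta\nabla F(\theta_t)+\gamma(\theta_t-\theta_{t-1}).$$ Here $F=R_S$ and $\hat\theta_T=\theta_T$. An algorithm with output $\hat\theta_S$ on sample $S$ is $\epsilon$-uniformly stable if for all $k\in\{1,\dots,n\}$ and all sample pairs $S=(z_1,\dots,z_k,\dots,z_n)$, $S'=(z_1,\dots,z_k',\dots,z_n)$, each $z_i$ or $z_k'$ sampled i.i.d. from $P$, one has $\sup_{z\in\mathcal Z}|l(\hat\theta_S;z)-l(\hat\theta_{S'};z)|\le\epsilon$;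 $\mathcal E_{\mathrm{stab}}(\hat\theta,l,P,n)$ denotes the uniform stability (the smallest such $\epsilon$). A function $f$ is $L$-Lipschitz if $|f(u)-f(v)|\le L\|u-v\|_2$; a continuously differentiable $f$ is $\beta$-smooth if $\|\nabla f(u)-\nabla f(v)\|_2\le\beta\|u-v\|_2$; $f$ is convex if $f(u)\ge f(v)+\langle\nabla f(v),u-v\rangle$; in each case for all $u,v\in\Omega$.
   Formalization: The formal statement assumes that all heavy ball iterates up to T stay in the domain for every sample (the unprojected method is otherwise undefined, as the loss lives only on the domain) and that the domain lies in the closure of its interior, so gradients on it are determined. *)

theory Defs
  imports "HOL-Probability.Probability"
begin

definition grad :: "('a::real_inner \<Rightarrow> real) \<Rightarrow> 'a \<Rightarrow> 'a" where
  "grad f x = (THE g. GDERIV f x :> g)"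

text \<open>The Lipschitz condition on the gradient already gives its continuity, so only
  differentiability has to be added to cover continuously differentiable functions.\<close>

definition smooth_fun_on :: "real \<Rightarrow> 'a::real_inner set \<Rightarrow> ('a \<Rightarrow> real) \<Rightarrow> bool" where
  "smooth_fun_on \<beta> \<Omega> f \<longleftrightarrow>
     (\<forall>x\<in>\<Omega>. \<exists>g. GDERIV f x :> g) \<and> \<beta>-lipschitz_on \<Omega> (grad f)"

text \<open>First-order convexity. Unlike the library's \<open>convex_on\<close>, it does not require the set
  to be convex.\<close>

definition convex_fun_on :: "'a::real_inner set \<Rightarrow> ('a \<Rightarrow> real) \<Rightarrow> bool" where
  "convex_fun_on \<Omega> f \<longleftrightarrow> (\<forall>u\<in>\<Omega>. \<forall>v\<in>\<Omega>. f u \<ge> f v + grad f v \<bullet> (u - v))"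

definition quadratic_fun :: "(real ^ 'd \<Rightarrow> real) \<Rightarrow> bool" where
  "quadratic_fun f \<longleftrightarrow>
     (\<exists>A b c. transpose A = A \<and> (\<forall>x. f x = 1/2 * (x \<bullet> (A *v x)) + b \<bullet> x + c))"

text \<open>A sample of size \<open>n\<close> is an element \<open>S\<close> of the product space with index set \<open>{1..n}\<close>.\<close>

definition emp_risk :: "('a \<Rightarrow> 'z \<Rightarrow> real) \<Rightarrow> nat \<Rightarrow> (nat \<Rightarrow> 'z) \<Rightarrow> 'a \<Rightarrow> real" where
  "emp_risk l n S \<theta> = (1 / real n) * (\<Sum>j=1..n. l \<theta> (S j))"

fun heavy_ball ::
  "real \<Rightarrow> real \<Rightarrow> ('a::real_inner \<Rightarrow> real) \<Rightarrow> 'a \<Rightarrow> 'a \<Rightarrow> nat \<Rightarrow> 'a" where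
  "heavy_ball \<eta> \<gamma> F \<theta>\<^sub>0 \<theta>\<^sub>1 0 = \<theta>\<^sub>0"
| "heavy_ball \<eta> \<gamma> F \<theta>\<^sub>0 \<theta>\<^sub>1 (Suc 0) = \<theta>\<^sub>1"
| "heavy_ball \<eta> \<gamma> F \<theta>\<^sub>0 \<theta>\<^sub>1 (Suc (Suc t)) =
     heavy_ball \<eta> \<gamma> F \<theta>\<^sub>0 \<theta>\<^sub>1 (Suc t)
     - \<eta> *\<^sub>R grad F (heavy_ball \<eta> \<gamma> F \<theta>\<^sub>0 \<theta>\<^sub>1 (Suc t))
     + \<gamma> *\<^sub>R (heavy_ball \<eta> \<gamma> F \<theta>\<^sub>0 \<theta>\<^sub>1 (Suc t) - heavy_ball \<eta> \<gamma> F \<theta>\<^sub>0 \<theta>\<^sub>1 t)"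

text \<open>Here \<open>alg\<close> maps a sample to the output of the algorithm, and the sample space is
  \<open>space P\<close>. The condition is imposed on all pairs of samples differing in one entry, not
  just almost all of them. The supremum is taken in the extended reals because real suprema
  of unbounded sets are unspecified.\<close>

definition uniformly_stable ::
  "real \<Rightarrow> ((nat \<Rightarrow> 'z) \<Rightarrow> 'a) \<Rightarrow> ('a \<Rightarrow> 'z \<Rightarrow> real) \<Rightarrow> 'z measure \<Rightarrow> nat \<Rightarrow> bool" where
  "uniformly_stable \<epsilon> alg l P n \<longleftrightarrow>
     (\<forall>k\<in>{1..n}. \<forall>S\<in>space (Pi\<^sub>M {1..n} (\<lambda>_. P)). \<forall>z'\<in>space P.
        (SUP z\<in>space P. ereal \<bar>l (alg S) z - l (alg (S(k := z'))) z\<bar>) \<le> ereal \<epsilon>)"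

text \<open>The value is \<open>\<infinity>\<close> if the algorithm is not uniformly stable for any \<open>\<epsilon>\<close>.\<close>

definition stab ::
  "((nat \<Rightarrow> 'z) \<Rightarrow> 'a) \<Rightarrow> ('a \<Rightarrow> 'z \<Rightarrow> real) \<Rightarrow> 'z measure \<Rightarrow> nat \<Rightarrow> ereal" where
  "stab alg l P n = (INF \<epsilon>\<in>{\<epsilon>. uniformly_stable \<epsilon> alg l P n}. ereal \<epsilon>)"

end

theory Submission
  imports Defs
begin

text \<open>The difference \<open>x\<close> of the iterates for two samples that differ in one entry is itself a
  heavy ball sequence for a quadratic with positive semidefinite Hessian \<open>H \<le> \<beta>\<close>, driven by a
  force of norm at most \<open>2 * \<eta> * L / n\<close>. With \<open>h = \<eta> H \<le> 1 - \<gamma>\<close>, the unforced step does not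
  increase the energy \<open>\<parallel>x\<^sub>t\<^sub>+\<^sub>1 - \<gamma> x\<^sub>t\<parallel>\<^sup>2 + \<gamma> (x\<^sub>t \<bullet> h x\<^sub>t)\<close>, so the square root of the energy
  grows by at most \<open>2 * \<eta> * L / n\<close> per step. As \<open>x\<^sub>t\<^sub>+\<^sub>1 = \<gamma> x\<^sub>t + (x\<^sub>t\<^sub>+\<^sub>1 - \<gamma> x\<^sub>t)\<close>, this gives
  \<open>\<parallel>x\<^sub>T\<parallel> \<le> 2 * \<eta> * L * T / ((1 - \<gamma>) * n)\<close>, and \<open>1 - \<gamma> \<ge> 1 - sqrt \<gamma>\<close>. Working with the
  energy avoids diagonalising \<open>H\<close>.\<close>

section \<open>Perturbed heavy ball iteration on a quadratic\<close>

text \<open>Positivity of the form at \<open>\<beta> *\<^sub>R x - H x\<close> gives the operator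
  inequality \<open>H\<^sup>2 \<le> \<beta> H\<close> with no appeal to eigenvalues.\<close>

lemma psd_norm_sq_le:
  fixes H :: "'a::real_inner \<Rightarrow> 'a"
  assumes lin: "linear H"
    and sym: "\<And>x y. H x \<bullet> y = x \<bullet> H y"
    and psd: "\<And>x. 0 \<le> x \<bullet> H x"
    and bd: "\<And>x. norm (H x) \<le> \<beta> * norm x"
    and "0 < \<beta>"
  shows "(norm (H x))\<^sup>2 \<le> \<beta> * (x \<bullet> H x)"
proof -
  define g where "g = H x"
  have "g \<bullet> H g \<le> norm g * norm (H g)"
    by (rule norm_cauchy_schwarz)
  also have "\<dots> \<le> norm g * (\<beta> * norm g)"
    by (intro mult_left_mono bd) auto
  finally have g: "g \<bullet> H g \<le> \<beta> * (norm g)\<^sup>2"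
    by (simp add: power2_eq_square algebra_simps)
  have "0 \<le> (\<beta> *\<^sub>R x - g) \<bullet> H (\<beta> *\<^sub>R x - g)"
    by (rule psd)
  also have "\<dots> = \<beta>\<^sup>2 * (x \<bullet> g) - 2 * \<beta> * (norm g)\<^sup>2 + g \<bullet> H g"
    using sym[of x g]
    by (simp add: g_def linear_diff[OF lin] linear_scale[OF lin] inner_diff
        dot_square_norm inner_commute algebra_simps power2_eq_square)
  also have "\<dots> \<le> \<beta> * (\<beta> * (x \<bullet> g) - (norm g)\<^sup>2)"
    using g by (simp add: algebra_simps power2_eq_square)
  finally show ?thesis
    using \<open>0 < \<beta>\<close> by (simp add: zero_le_mult_iff g_def)
qed

text \<open>Here \<open>w\<close> and \<open>x\<close> are consecutive iterates, and
  \<open>x - \<gamma> *\<^sub>R w - h x\<close> is the next value of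
  \<open>x - \<gamma> *\<^sub>R w\<close>, because the \<open>\<gamma> *\<^sub>R x\<close> of the
  momentum term cancels. In the expanded square, positivity at \<open>x - w\<close> absorbs the
  cross term and \<open>co\<close> absorbs the square of \<open>h x\<close>.\<close>

lemma heavy_ball_energy_decreasing:
  fixes h :: "'a::real_inner \<Rightarrow> 'a"
  assumes lin: "linear h"
    and sym: "\<And>x y. h x \<bullet> y = x \<bullet> h y"
    and psd: "\<And>x. 0 \<le> x \<bullet> h x"
    and co: "\<And>x. (norm (h x))\<^sup>2 \<le> (1 - \<gamma>) * (x \<bullet> h x)"
    and \<gamma>: "0 \<le> \<gamma>" "\<gamma> \<le> 1"
  shows "(norm (x - \<gamma> *\<^sub>R w - h x))\<^sup>2 + \<gamma> * (x \<bullet> h x)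
    \<le> (norm (x - \<gamma> *\<^sub>R w))\<^sup>2 + \<gamma> * (w \<bullet> h w)"
proof -
  have "0 \<le> (x - w) \<bullet> h (x - w)"
    by (rule psd)
  also have "\<dots> = x \<bullet> h x + w \<bullet> h w - 2 * (w \<bullet> h x)"
    using sym[of x w] by (simp add: linear_diff[OF lin] inner_diff inner_commute)
  finally have "\<gamma> * (2 * (w \<bullet> h x)) \<le> \<gamma> * (x \<bullet> h x + w \<bullet> h w)"
    by (intro mult_left_mono \<gamma>) simp
  moreover have "(norm (x - \<gamma> *\<^sub>R w - h x))\<^sup>2
    = (norm (x - \<gamma> *\<^sub>R w))\<^sup>2 - 2 * (x \<bullet> h x) + \<gamma> * (2 * (w \<bullet> h x)) + (norm (h x))\<^sup>2"
    unfolding power2_norm_eq_inner by (simp add: inner_diff inner_commute algebra_simps)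
  \<comment> \<open>The other estimates add up with exactly this much to spare.\<close>
  moreover have "0 \<le> (1 - \<gamma>) * (x \<bullet> h x)"
    using psd \<gamma> by simp
  ultimately show ?thesis
    using co[of x] by (simp add: algebra_simps)
qed

lemma perturbed_heavy_ball_bound:
  fixes h :: "'a::real_inner \<Rightarrow> 'a" and x e :: "nat \<Rightarrow> 'a"
  assumes lin: "linear h"
    and sym: "\<And>x y. h x \<bullet> y = x \<bullet> h y"
    and psd: "\<And>x. 0 \<le> x \<bullet> h x"
    and co: "\<And>x. (norm (h x))\<^sup>2 \<le> (1 - \<gamma>) * (x \<bullet> h x)"
    and \<gamma>: "0 \<le> \<gamma>" "\<gamma> < 1"
    and init: "x 0 = 0" "x 1 = 0"
    and step: "\<And>t. x (Suc (Suc t)) =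
      x (Suc t) - h (x (Suc t)) + \<gamma> *\<^sub>R (x (Suc t) - x t) - e t"
    \<comment> \<open>The iterate \<open>x T\<close> depends on \<open>e t\<close> only for
      \<open>t + 2 \<le> T\<close>.\<close>
    and force: "\<And>t. Suc t < T \<Longrightarrow> norm (e t) \<le> r"
    and "0 \<le> r"
  shows "norm (x T) \<le> r * real T / (1 - \<gamma>)"
proof -
  define E where "E t = sqrt ((norm (x (Suc t) - \<gamma> *\<^sub>R x t))\<^sup>2 + \<gamma> * (x t \<bullet> h (x t)))" for t
  have E: "E t \<le> r * real t" if "Suc t \<le> T" for t
    using that
  proof (induction t)
    case 0
    then show ?case
      using init by (simp add: E_def)
  next
    case (Suc t)
    define a where "a = x (Suc t) - \<gamma> *\<^sub>R x t - h (x (Suc t))"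
    \<comment> \<open>This part of the new energy involves only \<open>x (Suc t)\<close>, so the
      force \<open>e t\<close> leaves it unchanged.\<close>
    define q where "q = sqrt (\<gamma> * (x (Suc t) \<bullet> h (x (Suc t))))"
    have q: "q\<^sup>2 = \<gamma> * (x (Suc t) \<bullet> h (x (Suc t)))"
      unfolding q_def using \<gamma> psd by simp
    have "x (Suc (Suc t)) - \<gamma> *\<^sub>R x (Suc t) = a - e t"
      by (simp add: step a_def algebra_simps)
    then have "E (Suc t) = sqrt ((norm (a - e t))\<^sup>2 + q\<^sup>2)"
      by (simp add: E_def q)
    \<comment> \<open>The padding by \<open>0\<close> shows the plane vectors
      \<open>(norm a, q)\<close> and \<open>(norm (e t), 0)\<close>, whose triangle inequality
      separates the unforced step from the force.\<close>
    also have "\<dots> \<le> sqrt ((norm a + norm (e t))\<^sup>2 + (q + 0)\<^sup>2)"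
      by (intro real_sqrt_le_mono add_mono power_mono norm_triangle_ineq4) (auto simp: q_def \<gamma> psd)
    also have "\<dots> \<le> sqrt ((norm a)\<^sup>2 + q\<^sup>2) + sqrt ((norm (e t))\<^sup>2 + 0\<^sup>2)"
      by (rule real_sqrt_sum_squares_triangle_ineq)
    also have "sqrt ((norm a)\<^sup>2 + q\<^sup>2) \<le> E t"
      unfolding E_def q a_def using \<gamma>
      by (intro real_sqrt_le_mono heavy_ball_energy_decreasing lin sym psd co) auto
    also have "E t \<le> r * real t"
      using Suc by simp
    also have "sqrt ((norm (e t))\<^sup>2 + 0\<^sup>2) \<le> r"
      using force[of t] Suc.prems by simp
    finally show ?case
      by (simp add: algebra_simps)
  qed
  have "norm (x t) \<le> r * real t / (1 - \<gamma>)" if "t \<le> T" for t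
    using that
  proof (induction t)
    case 0
    then show ?case
      using init by simp
  next
    case (Suc t)
    have "norm (x (Suc t)) \<le> norm (x (Suc t) - \<gamma> *\<^sub>R x t) + norm (\<gamma> *\<^sub>R x t)"
      using norm_triangle_sub[of "x (Suc t)" "\<gamma> *\<^sub>R x t"] by simp
    also have "norm (x (Suc t) - \<gamma> *\<^sub>R x t) \<le> E t"
      unfolding E_def using \<gamma> psd by (intro real_le_rsqrt) simp
    also have "E t \<le> r * real t"
      using E Suc by simp
    also have "norm (\<gamma> *\<^sub>R x t) \<le> \<gamma> * (r * real t / (1 - \<gamma>))"
      using Suc \<gamma> by (simp only: norm_scaleR abs_of_nonneg) (intro mult_left_mono; simp)
    \<comment> \<open>The claimed bound is the fixed point of
      \<open>s \<mapsto> r * real t + \<gamma> * s\<close>.\<close>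
    also have "r * real t + \<gamma> * (r * real t / (1 - \<gamma>)) = r * real t / (1 - \<gamma>)"
      using \<gamma> by (simp add: field_simps)
    also have "\<dots> \<le> r * real (Suc t) / (1 - \<gamma>)"
      using \<gamma> \<open>0 \<le> r\<close> by (intro divide_right_mono mult_left_mono) auto
    finally show ?case
      by simp
  qed
  then show ?thesis
    by simp
qed

section \<open>Quadratic losses\<close>

lemma grad_eqI: "GDERIV f x :> g \<Longrightarrow> grad f x = g"
  unfolding grad_def
proof (rule the_equality)
  fix g' assume "GDERIV f x :> g" "GDERIV f x :> g'"
  then have "(\<lambda>v. v \<bullet> g') = (\<lambda>v. v \<bullet> g)"
    unfolding gderiv_def by (rule has_derivative_unique[rotated])
  then have "v \<bullet> g' = v \<bullet> g" for v
    by metis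
  then show "g' = g"
    by (metis vector_eq_rdot inner_commute)
qed

lemma GDERIV_sum:
  assumes "\<And>i. i \<in> I \<Longrightarrow> GDERIV (f i) x :> g i"
  shows "GDERIV (\<lambda>x. \<Sum>i\<in>I. f i x) x :> (\<Sum>i\<in>I. g i)"
  using assms unfolding gderiv_def inner_sum_right by (intro has_derivative_sum)

text \<open>Allows a condition on \<open>\<Omega>\<close> to be tested in an arbitrary direction;
  the scale \<open>s\<close> later cancels by homogeneity.\<close>

lemma interior_point_direction:
  fixes p x :: "'a::real_normed_vector"
  assumes "p \<in> interior \<Omega>"
  obtains s where "0 < s" "p + s *\<^sub>R x \<in> \<Omega>" "p \<in> \<Omega>"
proof -
  have "((\<lambda>s. p + s *\<^sub>R x) \<longlongrightarrow> p + 0 *\<^sub>R x) (at_right 0)"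
    by (intro tendsto_intros)
  then have "\<forall>\<^sub>F s in at_right 0. p + s *\<^sub>R x \<in> interior \<Omega>"
    using assms by (auto dest: topological_tendstoD[OF _ open_interior])
  moreover have "\<forall>\<^sub>F s in at_right 0. (0::real) < s"
    by (rule eventually_at_right_less)
  ultimately have "\<forall>\<^sub>F s in at_right 0. (0::real) < s \<and> p + s *\<^sub>R x \<in> interior \<Omega>"
    by eventually_elim simp
  then obtain s :: real where "0 < s" "p + s *\<^sub>R x \<in> interior \<Omega>"
    using eventually_happens'[OF trivial_limit_at_right_real] by blast
  then show thesis
    using assms interior_subset that by blast
qed

lemma symmetric_matrix_inner:
  fixes A :: "real ^ 'd ^ 'd"
  assumes "transpose A = A"
  shows "(A *v x) \<bullet> y = x \<bullet> (A *v y)"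
  by (metis assms dot_lmul_matrix transpose_matrix_vector)

context
  fixes A :: "real ^ 'd ^ 'd" and b :: "real ^ 'd" and c :: real and f :: "real ^ 'd \<Rightarrow> real"
  assumes sym: "transpose A = A"
    and f: "\<And>x. f x = 1/2 * (x \<bullet> (A *v x)) + b \<bullet> x + c"
begin

lemma GDERIV_quadratic: "GDERIV f x :> A *v x + b"
proof -
  have "(f has_derivative (\<lambda>v. 1/2 * (x \<bullet> (A *v v) + v \<bullet> (A *v x)) + b \<bullet> v)) (at x)"
    unfolding f
    by (rule derivative_eq_intros bounded_linear_imp_has_derivative
        matrix_vector_mul_bounded_linear refl | simp)+
  moreover have "1/2 * (x \<bullet> (A *v v) + v \<bullet> (A *v x)) + b \<bullet> v = v \<bullet> (A *v x + b)" for v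
    using symmetric_matrix_inner[OF sym, of x v] by (simp add: inner_add_right inner_commute)
  ultimately show ?thesis
    unfolding gderiv_def by simp
qed

text \<open>The second-order Taylor expansion at \<open>v\<close> is exact for a quadratic.\<close>

lemma quadratic_diff: "f u - f v = (A *v v + b) \<bullet> (u - v) + 1/2 * ((u - v) \<bullet> (A *v (u - v)))"
  using symmetric_matrix_inner[OF sym, of u v]
  by (simp add: f matrix_vector_mult_diff_distrib inner_diff inner_add_left inner_commute
      algebra_simps)

text \<open>Convexity and smoothness on a set with interior points extend to the whole space, because
  the Hessian is constant.\<close>

lemma convex_quadratic_psd:
  assumes "convex_fun_on \<Omega> f" and "p \<in> interior \<Omega>"
  shows "0 \<le> x \<bullet> (A *v x)"
proof -
  obtain s where s: "0 < s" "p + s *\<^sub>R x \<in> \<Omega>" "p \<in> \<Omega>"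
    using interior_point_direction[OF assms(2)] .
  then have "f (p + s *\<^sub>R x) \<ge> f p + grad f p \<bullet> (p + s *\<^sub>R x - p)"
    using assms(1) unfolding convex_fun_on_def by blast
  then have "0 \<le> s * (s * (x \<bullet> (A *v x)))"
    using quadratic_diff[of "p + s *\<^sub>R x" p]
    by (simp add: grad_eqI[OF GDERIV_quadratic] matrix_vector_mult_scaleR)
  then show ?thesis
    using s by (simp add: zero_le_mult_iff)
qed

lemma smooth_quadratic_norm_le:
  assumes "smooth_fun_on \<beta> \<Omega> f" and "p \<in> interior \<Omega>"
  shows "norm (A *v x) \<le> \<beta> * norm x"
proof -
  obtain s where s: "0 < s" "p + s *\<^sub>R x \<in> \<Omega>" "p \<in> \<Omega>"
    using interior_point_direction[OF assms(2)] .
  then have "dist (grad f (p + s *\<^sub>R x)) (grad f p) \<le> \<beta> * dist (p + s *\<^sub>R x) p"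
    using assms(1) unfolding smooth_fun_on_def by (blast intro: lipschitz_onD)
  then have "s * norm (A *v x) \<le> s * (\<beta> * norm x)"
    using s by (simp add: grad_eqI[OF GDERIV_quadratic] dist_norm matrix_vector_mult_scaleR
        matrix_vector_right_distrib mult_ac)
  then show ?thesis
    using s by simp
qed

text \<open>Moving from an interior point along its gradient \<open>g\<close> by \<open>s\<close>,
  convexity makes \<open>f\<close> rise by at least \<open>s * (norm g)\<^sup>2\<close>, while the
  Lipschitz condition allows at most \<open>L * s * norm g\<close>. Continuity of the gradient
  carries the bound to the closure of the interior.\<close>

lemma lipschitz_quadratic_gradient_le:
  assumes lip: "L-lipschitz_on \<Omega> f" and conv: "convex_fun_on \<Omega> f"
    and \<Omega>: "\<Omega> \<subseteq> closure (interior \<Omega>)" and "x \<in> \<Omega>"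
  shows "norm (A *v x + b) \<le> L"
proof -
  have "norm (A *v p + b) \<le> L" if p: "p \<in> interior \<Omega>" for p
  proof -
    define g where "g = A *v p + b"
    obtain s where s: "0 < s" "p + s *\<^sub>R g \<in> \<Omega>" "p \<in> \<Omega>"
      using interior_point_direction[OF p] .
    have "0 \<le> (s *\<^sub>R g) \<bullet> (A *v (s *\<^sub>R g))"
      by (rule convex_quadratic_psd[OF conv p])
    then have "s * (g \<bullet> g) \<le> f (p + s *\<^sub>R g) - f p"
      using quadratic_diff[of "p + s *\<^sub>R g" p] by (simp add: g_def)
    also have "\<dots> \<le> dist (f (p + s *\<^sub>R g)) (f p)"
      by (simp add: dist_real_def)
    also have "\<dots> \<le> L * dist (p + s *\<^sub>R g) p"
      using lip s by (blast intro: lipschitz_onD)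
    finally have "s * (norm g * norm g) \<le> s * (L * norm g)"
      using s by (simp add: dist_norm dot_square_norm power2_eq_square mult_ac)
    then have "norm g * norm g \<le> L * norm g"
      using s by simp
    then show ?thesis
      using lipschitz_on_nonneg[OF lip] unfolding g_def[symmetric]
      by (cases "norm g = 0") (auto simp: mult_le_cancel_right)
  qed
  moreover have "closed {p. norm (A *v p + b) \<le> L}"
    by (intro closed_Collect_le continuous_intros matrix_vector_mult_linear_continuous_on)
  ultimately have "closure (interior \<Omega>) \<subseteq> {p. norm (A *v p + b) \<le> L}"
    by (intro closure_minimal) auto
  then show ?thesis
    using assms by blast
qed

end

section \<open>Uniform stability of heavy ball on the empirical risk\<close>

theorem theorem12:
  fixes P :: "'z measure"
    and \<Omega> :: "(real ^ 'd) set"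
    and l :: "real ^ 'd \<Rightarrow> 'z \<Rightarrow> real"
    and L \<beta> \<eta> \<gamma> :: real
    and \<theta>\<^sub>0 \<theta>\<^sub>1 :: "real ^ 'd"
    and n T :: nat
  assumes "prob_space P"
    and "bounded \<Omega>" and "\<Omega> \<subseteq> closure (interior \<Omega>)"
    and "\<And>z. z \<in> space P \<Longrightarrow> quadratic_fun (\<lambda>\<theta>. l \<theta> z)"
    and "\<And>z. z \<in> space P \<Longrightarrow> L-lipschitz_on \<Omega> (\<lambda>\<theta>. l \<theta> z)"
    and "\<And>z. z \<in> space P \<Longrightarrow> smooth_fun_on \<beta> \<Omega> (\<lambda>\<theta>. l \<theta> z)"
    and "\<And>z. z \<in> space P \<Longrightarrow> convex_fun_on \<Omega> (\<lambda>\<theta>. l \<theta> z)"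
    and "0 \<le> \<gamma>" and "\<gamma> < 1"
    and "0 < \<eta>" and "\<eta> < (1 - \<gamma>) / \<beta>"
    and "n \<ge> 1" and "T \<ge> 1"
    and "\<And>S t. S \<in> space (Pi\<^sub>M {1..n} (\<lambda>_. P)) \<Longrightarrow> t \<le> T \<Longrightarrow>
           heavy_ball \<eta> \<gamma> (emp_risk l n S) \<theta>\<^sub>0 \<theta>\<^sub>1 t \<in> \<Omega>"
  shows "stab (\<lambda>S. heavy_ball \<eta> \<gamma> (emp_risk l n S) \<theta>\<^sub>0 \<theta>\<^sub>1 T) l P n
           \<le> ereal (4 * \<eta> * L\<^sup>2 * real T / ((1 - sqrt \<gamma>) * real n))"
proof -
  let ?y = "\<lambda>S. heavy_ball \<eta> \<gamma> (emp_risk l n S) \<theta>\<^sub>0 \<theta>\<^sub>1"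
  let ?\<epsilon> = "4 * \<eta> * L\<^sup>2 * real T / ((1 - sqrt \<gamma>) * real n)"
  have "\<forall>z\<in>space P. \<exists>A b c. transpose A = A \<and> (\<forall>x. l x z = 1/2 * (x \<bullet> (A *v x)) + b \<bullet> x + c)"
    using assms(4) unfolding quadratic_fun_def by blast
  then obtain A b c where sym: "\<And>z. z \<in> space P \<Longrightarrow> transpose (A z) = A z"
    and lz: "\<And>z x. z \<in> space P \<Longrightarrow> l x z = 1/2 * (x \<bullet> (A z *v x)) + b z \<bullet> x + c z"
    by metis
  define g where "g z x = A z *v x + b z" for z x
  define G where "G S x = (1 / real n) *\<^sub>R (\<Sum>j=1..n. g (S j) x)" for S :: "nat \<Rightarrow> 'z" and x
  \<comment> \<open>The step-size range is nonempty, which forces \<beta> to be positive; zero is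
    excluded because division by zero yields zero.\<close>
  have "0 < (1 - \<gamma>) / \<beta>"
    using \<open>0 < \<eta>\<close> \<open>\<eta> < (1 - \<gamma>) / \<beta>\<close> by linarith
  then have "0 < \<beta>"
    using \<open>\<gamma> < 1\<close> by (simp add: zero_less_divide_iff)
  then have \<eta>\<beta>: "\<eta> * \<beta> \<le> 1 - \<gamma>"
    using \<open>\<eta> < (1 - \<gamma>) / \<beta>\<close> by (simp add: field_simps)
  have n: "0 < real n"
    using \<open>n \<ge> 1\<close> by simp
  have space_S: "S j \<in> space P" if "S \<in> space (Pi\<^sub>M {1..n} (\<lambda>_. P))" "j \<in> {1..n}" for S j
    using that by (auto simp: space_PiM)
  have grad_emp_risk: "grad (emp_risk l n S) x = G S x"
    if S: "S \<in> space (Pi\<^sub>M {1..n} (\<lambda>_. P))" for S x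
  proof (rule grad_eqI)
    have "GDERIV (\<lambda>\<theta>. \<Sum>j=1..n. l \<theta> (S j)) x :> (\<Sum>j=1..n. g (S j) x)"
      unfolding g_def by (intro GDERIV_sum GDERIV_quadratic[OF sym lz] space_S[OF S])
    then have "((\<lambda>\<theta>. (1 / real n) * (\<Sum>j=1..n. l \<theta> (S j))) has_derivative
        (\<lambda>v. (1 / real n) * (v \<bullet> (\<Sum>j=1..n. g (S j) x)))) (at x)"
      unfolding gderiv_def by (rule has_derivative_mult_right)
    then show "GDERIV (emp_risk l n S) x :> G S x"
      unfolding gderiv_def emp_risk_def G_def by simp
  qed
  have "uniformly_stable ?\<epsilon> (\<lambda>S. ?y S T) l P n"
    unfolding uniformly_stable_def
  proof (intro ballI SUP_least)
    fix k S z' z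
    assume k: "k \<in> {1..n}" and S: "S \<in> space (Pi\<^sub>M {1..n} (\<lambda>_. P))"
      and z': "z' \<in> space P" and z: "z \<in> space P"
    define S' where "S' = S(k := z')"
    have S': "S' \<in> space (Pi\<^sub>M {1..n} (\<lambda>_. P))"
      using S z' k unfolding S'_def space_PiM by (auto simp: PiE_iff extensional_def)
    have in_\<Omega>: "?y S t \<in> \<Omega>" "?y S' t \<in> \<Omega>" if "t \<le> T" for t
      using assms(14) S S' that by auto
    \<comment> \<open>The starting point lies in \<Omega>, hence in the closure of its
      interior.\<close>
    have "interior \<Omega> \<noteq> {}"
      using in_\<Omega>[of 0] \<open>\<Omega> \<subseteq> closure (interior \<Omega>)\<close> by auto
    then obtain p where p: "p \<in> interior \<Omega>"
      by blast
    have psd_A: "0 \<le> x \<bullet> (A z *v x)" if "z \<in> space P" for z x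
      using convex_quadratic_psd[OF sym lz assms(7) p] that by blast
    have norm_A: "norm (A z *v x) \<le> \<beta> * norm x" if "z \<in> space P" for z x
      using smooth_quadratic_norm_le[OF sym lz assms(6) p] that by blast
    have norm_g: "norm (g z x) \<le> L" if "z \<in> space P" "x \<in> \<Omega>" for z x
      using lipschitz_quadratic_gradient_le[OF sym lz assms(5,7) assms(3)] that
      unfolding g_def by blast
    have "0 \<le> L"
      using assms(5)[OF z] by (rule lipschitz_on_nonneg)

    \<comment> \<open>This is \<eta> times the Hessian of the empirical risk of
      \<open>S\<close>.\<close>
    define h where "h x = (\<eta> / real n) *\<^sub>R (\<Sum>j=1..n. A (S j) *v x)" for x
    have lin: "linear h"
      unfolding h_def
      by (intro linear_compose_scale_right linear_compose_sum ballI matrix_vector_mul_linear)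
    have sym_h: "h x \<bullet> y = x \<bullet> h y" for x y
      using symmetric_matrix_inner[OF sym[OF space_S[OF S]]]
      by (simp add: h_def inner_sum_left inner_sum_right)
    have psd_h: "0 \<le> x \<bullet> h x" for x
      using psd_A[OF space_S[OF S]] \<open>0 < \<eta>\<close> unfolding h_def inner_scaleR_right inner_sum_right
      by (intro mult_nonneg_nonneg sum_nonneg) auto
    have norm_h: "norm (h x) \<le> (1 - \<gamma>) * norm x" for x
    proof -
      have "norm (h x) \<le> (\<eta> / real n) * (\<Sum>j=1..n. \<beta> * norm x)"
        unfolding h_def using \<open>0 < \<eta>\<close> norm_A[OF space_S[OF S]]
        by (simp only: norm_scaleR) (intro mult_mono sum_norm_le; simp)
      also have "\<dots> = \<eta> * \<beta> * norm x"
        using n by simp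
      also have "\<dots> \<le> (1 - \<gamma>) * norm x"
        using \<eta>\<beta> by (intro mult_right_mono) auto
      finally show ?thesis .
    qed
    \<comment> \<open>The step-size restriction enters here, through \<open>norm_h\<close>.\<close>
    have co: "(norm (h x))\<^sup>2 \<le> (1 - \<gamma>) * (x \<bullet> h x)" for x
      using \<open>\<gamma> < 1\<close> by (intro psd_norm_sq_le lin sym_h psd_h norm_h) simp

    \<comment> \<open>The gradient difference of the two runs splits at
      \<open>G S (?y S' (Suc t))\<close>: the change of point gives \<open>h\<close>, the change of
      sample gives \<open>e\<close>. In \<open>e\<close> only the \<open>k\<close>-th summand
      survives, a difference of two gradients of norm at most \<open>L\<close>.\<close>
    define e where "e t = \<eta> *\<^sub>R (G S (?y S' (Suc t)) - G S' (?y S' (Suc t)))" for t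
    have G_diff: "\<eta> *\<^sub>R (G S u - G S v) = h (u - v)" for u v
      unfolding G_def h_def g_def
      by (simp add: matrix_vector_mult_diff_distrib sum.distrib sum_subtractf
          flip: scaleR_diff_right)
    have norm_e: "norm (e t) \<le> 2 * \<eta> * L / real n" if "Suc t < T" for t
    proof -
      let ?x = "?y S' (Suc t)"
      have "(\<Sum>j=1..n. g (S j) ?x) - (\<Sum>j=1..n. g (S' j) ?x)
          = (\<Sum>j=1..n. if j = k then g (S k) ?x - g z' ?x else 0)"
        unfolding sum_subtractf[symmetric] by (intro sum.cong) (auto simp: S'_def)
      also have "\<dots> = g (S k) ?x - g z' ?x"
        using k by simp
      finally have "e t = (\<eta> / real n) *\<^sub>R (g (S k) ?x - g z' ?x)"
        by (simp add: e_def G_def flip: scaleR_diff_right)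
      then have "norm (e t) = (\<eta> / real n) * norm (g (S k) ?x - g z' ?x)"
        using \<open>0 < \<eta>\<close> by simp
      also have "\<dots> \<le> (\<eta> / real n) * (L + L)"
        using that \<open>0 < \<eta>\<close>
        by (intro mult_left_mono norm_triangle_le_diff add_mono norm_g space_S[OF S k] z' in_\<Omega>) auto
      finally show ?thesis
        by (simp add: mult_ac)
    qed
    have step: "?y S (Suc (Suc t)) - ?y S' (Suc (Suc t)) =
        (?y S (Suc t) - ?y S' (Suc t)) - h (?y S (Suc t) - ?y S' (Suc t))
        + \<gamma> *\<^sub>R ((?y S (Suc t) - ?y S' (Suc t)) - (?y S t - ?y S' t)) - e t" for t
      by (simp add: grad_emp_risk[OF S] grad_emp_risk[OF S'] e_def algebra_simps flip: G_diff)
    \<comment> \<open>Both runs share their starting points, so the difference starts with two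
      zeros.\<close>
    have "norm (?y S T - ?y S' T) \<le> 2 * \<eta> * L / real n * real T / (1 - \<gamma>)"
      using assms(8,9,10) \<open>0 \<le> L\<close> step norm_e
      by (intro perturbed_heavy_ball_bound[OF lin sym_h psd_h co, where e = e]) auto
    then have "L * norm (?y S T - ?y S' T) \<le> L * (2 * \<eta> * L / real n * real T / (1 - \<gamma>))"
      using \<open>0 \<le> L\<close> by (rule mult_left_mono)
    also have "\<dots> = (2 * \<eta> * L\<^sup>2 * real T / real n) / (1 - \<gamma>)"
      by (simp add: power2_eq_square)
    \<comment> \<open>Both numerator and denominator are relaxed; the latter uses
      \<open>\<gamma> \<le> sqrt \<gamma>\<close> on the unit interval.\<close>
    also have "\<dots> \<le> (4 * \<eta> * L\<^sup>2 * real T / real n) / (1 - sqrt \<gamma>)"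
    proof (rule frac_le)
      have "sqrt \<gamma> * sqrt \<gamma> \<le> sqrt \<gamma> * 1"
        using assms(8,9) by (intro mult_left_mono) auto
      then show "1 - sqrt \<gamma> \<le> 1 - \<gamma>"
        using assms(8) by simp
    qed (use assms(8,9,10) in \<open>auto intro!: divide_right_mono mult_right_mono\<close>)
    also have "\<dots> = ?\<epsilon>"
      by (simp add: mult.commute)
    finally have "L * norm (?y S T - ?y S' T) \<le> ?\<epsilon>" .
    moreover have "dist (l (?y S T) z) (l (?y S' T) z) \<le> L * dist (?y S T) (?y S' T)"
      using lipschitz_onD[OF assms(5)[OF z]] in_\<Omega> by simp
    ultimately show "ereal \<bar>l (?y S T) z - l (?y (S(k := z')) T) z\<bar> \<le> ereal ?\<epsilon>"
      by (simp add: S'_def dist_norm)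
  qed
  then show ?thesis
    unfolding stab_def by (intro INF_lower) simp
qed

end
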